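(* Consider the system of $N$ pulse-coupled oscillators with delayed excitatory coupling described in the context, with delay $\tau$ and total coupling strength $\varepsilon$, where $0<\tau<1$ and $0<\varepsilon<1$. If $f(\tau)+\varepsilon<1$, then for every set of initial phases $0<\phi_i(0)\le 1$ ($i=1,\dots,N$), all interspike intervals of each oscillator are strictly longer than $\tau$; that is, if $t_1<t_2$ are two successive firing times of the same oscillator, then $t_2-t_1>\tau$.
   Context: The system: $N$ identical oscillators $i=1,\dots,N$ have phases $\phi_i(t)\in[0,1]$, $t\ge 0$. $\mathrm{Pre}(i)$ is the set of oscillators sending pulses to $i$, and $\mathrm{Post}(i)$ is the set of oscillators receiving pulses from $i$ (so $j\in\mathrm{Post}(i)$ iff $i\in\mathrm{Pre}(j)$). The function $f:[0,1]\to[0,1]$ is twice continuously differentiable with $f'>0$, $f''<0$, $f(0)=0$, $f(1)=1$. Dynamics: (1) In the absence of interaction, $\mathrm{d}\phi_i/\mathrm{d}t=1$. (2) When $\phi_i(t)=1$, oscillator $i$ fires at time $t$ and its phase is reset instantly: $\phi_i(t^+)=0$. (3) If oscillator $i$ fires at time $t$, it emits a spike, which reaches every $j\in\mathrm{Post}(i)$ at time $t+\tau$ and induces the phase jump $\phi_j(t+\tau)=f^{-1}(\min[1,f(\phi_j((t+\tau)^-))+\varepsilon_{ij}])$, where $\varepsilon_{ij}>0$ is the coupling strength from $i$ to $j$. If several spikes reach $j$ at the same time, their strengths are added in this formula. (A phase brought to $1$ by a jump at time $s$ means that the oscillator fires at time $s$.) Standing assumptions: the system starts at time $t=0$ with initial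 phases $0<\phi_i(0)\le 1$, and no spikes emitted before time $0$ are present; there is no self-interaction, i.e. $i\notin\mathrm{Pre}(i)$; $0<\tau<1$; and for all $i$, $\sum_{j\in\mathrm{Pre}(i)}\varepsilon_{ji}=\varepsilon$ with $0<\varepsilon<1$. An interspike interval is the time between two successive firings of one oscillator. *)

theory Defs
  imports Complex_Main
begin

definition rise_function :: "(real \<Rightarrow> real) \<Rightarrow> bool" where
  "rise_function f \<longleftrightarrow>
     f ` {0..1} \<subseteq> {0..1} \<and> f 0 = 0 \<and> f 1 = 1 \<and>
     (\<exists>f' f''.
        (\<forall>x\<in>{0..1}. (f has_real_derivative f' x) (at x within {0..1}) \<and> f' x > 0) \<and>
        (\<forall>x\<in>{0..1}. (f' has_real_derivative f'' x) (at x within {0..1}) \<and> f'' x < 0) \<and>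
        continuous_on {0..1} f'')"

definition Post :: "('n \<Rightarrow> 'n set) \<Rightarrow> 'n \<Rightarrow> 'n set" where
  "Post Pre i = {j. i \<in> Pre j}"

(* A trajectory \<phi> assigns to each oscillator i and each time t \<ge> 0 the phase \<phi> i t, taken after
   the jump caused by spikes arriving at t (if any) but before the reset (if any).
   So the phase equals 1 exactly at the firing times. Values at negative times are irrelevant. *)

definition fires :: "('n \<Rightarrow> real \<Rightarrow> real) \<Rightarrow> 'n \<Rightarrow> real \<Rightarrow> bool" where
  "fires \<phi> i t \<longleftrightarrow> t \<ge> 0 \<and> \<phi> i t = 1"

definition arriving :: "('n \<Rightarrow> 'n set) \<Rightarrow> real \<Rightarrow> ('n \<Rightarrow> real \<Rightarrow> real) \<Rightarrow> 'n \<Rightarrow> real \<Rightarrow> 'n set" where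
  "arriving Pre \<tau> \<phi> j s = {i. j \<in> Post Pre i \<and> fires \<phi> i (s - \<tau>)}"

(* The first two clauses say that the phase has slope 1 in the absence of interaction, in
   one-sided form: the left derivative at t is unaffected by a reset at t, and the right
   derivative by a spike arriving at t. When there is neither, they together give the ordinary
   derivative 1. Here w i j is the coupling strength from i to j. *)

definition trajectory ::
  "(real \<Rightarrow> real) \<Rightarrow> ('n::finite \<Rightarrow> 'n set) \<Rightarrow> ('n \<Rightarrow> 'n \<Rightarrow> real) \<Rightarrow> real \<Rightarrow>
   ('n \<Rightarrow> real \<Rightarrow> real) \<Rightarrow> bool" where
  "trajectory f Pre w \<tau> \<phi> \<longleftrightarrow>
     (\<forall>i. \<forall>t\<ge>0. \<phi> i t \<in> {0..1}) \<and>
     (\<forall>i. \<forall>t>0. arriving Pre \<tau> \<phi> i t = {} \<longrightarrow>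
        (\<phi> i has_real_derivative 1) (at_left t)) \<and>
     (\<forall>i. \<forall>t\<ge>0. \<not> fires \<phi> i t \<longrightarrow>
        (\<phi> i has_real_derivative 1) (at_right t)) \<and>
     (\<forall>i. \<forall>t\<ge>0. fires \<phi> i t \<longrightarrow> (\<phi> i \<longlongrightarrow> 0) (at_right t)) \<and>
     (\<forall>j. \<forall>s>0. arriving Pre \<tau> \<phi> j s \<noteq> {} \<longrightarrow>
        (\<exists>l. (\<phi> j \<longlongrightarrow> l) (at_left s) \<and>
             \<phi> j s = inv_into {0..1} f (min 1 (f l + (\<Sum>i\<in>arriving Pre \<tau> \<phi> j s. w i j)))))"

definition successive_firings :: "('n \<Rightarrow> real \<Rightarrow> real) \<Rightarrow> 'n \<Rightarrow> real \<Rightarrow> real \<Rightarrow> bool" where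
  "successive_firings \<phi> i t1 t2 \<longleftrightarrow>
     t1 < t2 \<and> fires \<phi> i t1 \<and> fires \<phi> i t2 \<and> (\<forall>t. t1 < t \<and> t < t2 \<longrightarrow> \<not> fires \<phi> i t)"

end

theory Submission
  imports Defs
begin

text \<open>If all interspike intervals ending by \<open>t2 - \<tau>\<close> exceed \<open>\<tau>\<close>, then an oscillator that
  fires at \<open>t1 \<ge> t2 - \<tau>\<close> receives at most one spike from each presynaptic oscillator during
  \<open>(t1, t2]\<close>, hence spikes of total strength at most \<open>\<epsilon>\<close>. By concavity of the rise function, the
  potential \<open>f (\<phi> i t)\<close> exceeds its value \<open>f (t - t1)\<close> without input by at most the
  strength received since the reset. So it stays below \<open>f \<tau> + \<epsilon> < 1\<close> and there is no
  firing at \<open>t2\<close>. Induction over time slabs of length \<open>\<tau>\<close> gives the theorem.\<close>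

section \<open>Tools on the real line: induction, gaps in finite sets, slope 1\<close>

text \<open>The infimum \<open>T\<close> of the counterexamples either equals \<open>a\<close> or
  satisfies \<open>P\<close> by \<open>left\<close>; then \<open>right\<close> keeps all
  counterexamples away from \<open>T\<close>, a contradiction. The alternative \<open>T = a\<close>
  allows \<open>P\<close> to fail at \<open>a\<close>, as the invariant used below does at a reset
  time, where the phase still equals 1.\<close>

lemma real_induction:
  fixes a b :: real
  assumes right: "\<And>T. a \<le> T \<Longrightarrow> T < b \<Longrightarrow> T = a \<or> P T \<Longrightarrow> \<exists>u>T. \<forall>t. T < t \<and> t < u \<longrightarrow> P t"
    and left: "\<And>T. a < T \<Longrightarrow> T \<le> b \<Longrightarrow> (\<And>t. a < t \<Longrightarrow> t < T \<Longrightarrow> P t) \<Longrightarrow> P T"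
    and t: "a < t" "t \<le> b"
  shows "P t"
proof (rule ccontr)
  assume "\<not> P t"
  define X where "X = {x. a < x \<and> x \<le> b \<and> \<not> P x}"
  define T where "T = Inf X"
  have tX: "t \<in> X" using t \<open>\<not> P t\<close> by (simp add: X_def)
  have bdd: "bdd_below X" by (rule bdd_belowI[of _ a]) (simp add: X_def)
  have Tle: "T \<le> x" if "x \<in> X" for x
    unfolding T_def by (rule cInf_lower[OF that bdd])
  have aT: "a \<le> T" unfolding T_def using tX by (intro cInf_greatest) (auto simp: X_def)
  have Tt: "T \<le> t" by (rule Tle[OF tX])
  have PT: "P T" if "a < T"
  proof (rule left[OF that])
    show "T \<le> b" using Tt t by simp
    show "P x" if "a < x" "x < T" for x
      using Tle[of x] that \<open>T \<le> b\<close> by (auto simp: X_def)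
  qed
  have "T \<noteq> b" using PT Tt t \<open>\<not> P t\<close> by force
  then have "T < b" using Tt t by simp
  moreover have "T = a \<or> P T" using PT aT by (cases "a < T") auto
  ultimately obtain u where u: "u > T" "\<forall>t. T < t \<and> t < u \<longrightarrow> P t"
    using right[OF aT] by blast
  have "u \<le> T" unfolding T_def
  proof (rule cInf_greatest)
    show "X \<noteq> {}" using tX by auto
    show "u \<le> x" if "x \<in> X" for x
    proof (rule ccontr)
      assume "\<not> u \<le> x"
      moreover have "T \<noteq> x" using that PT by (auto simp: X_def)
      ultimately show False using u Tle[OF that] that by (auto simp: X_def)
    qed
  qed
  with u show False by simp
qed

lemma finite_gap_right:
  fixes a b :: real
  assumes "finite A" "a < b"
  obtains u where "a < u" "u \<le> b" "\<And>x. a < x \<Longrightarrow> x < u \<Longrightarrow> x \<notin> A"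
proof
  let ?B = "insert b {x\<in>A. a < x}"
  have fin: "finite ?B" using assms by simp
  show "a < Min ?B" using assms fin by (subst Min_gr_iff) auto
  show "Min ?B \<le> b" using fin by (intro Min_le) auto
  show "x \<notin> A" if "a < x" "x < Min ?B" for x
    using that Min_le[OF fin, of x] by force
qed

lemma finite_gap_left:
  fixes a b :: real
  assumes "finite A" "a < b"
  obtains u where "a \<le> u" "u < b" "\<And>x. u < x \<Longrightarrow> x < b \<Longrightarrow> x \<notin> A"
proof
  let ?B = "insert a {x\<in>A. x < b}"
  have fin: "finite ?B" using assms by simp
  show "Max ?B < b" using assms fin by (subst Max_less_iff) auto
  show "a \<le> Max ?B" using fin by (intro Max_ge) auto
  show "x \<notin> A" if "Max ?B < x" "x < b" for x
    using that Max_ge[OF fin, of x] by force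
qed

text \<open>Matching one-sided derivatives give an ordinary derivative, so \<open>g x - x\<close> is
  constant. This turns the one-sided clauses of \<open>trajectory\<close> into an explicit formula
  for the phase between events.\<close>

lemma DERIV_one_affine:
  fixes g :: "real \<Rightarrow> real"
  assumes "\<And>x. a < x \<Longrightarrow> x < b \<Longrightarrow> (g has_real_derivative 1) (at_left x)"
    and "\<And>x. a < x \<Longrightarrow> x < b \<Longrightarrow> (g has_real_derivative 1) (at_right x)"
    and "a < b"
  obtains c where "\<And>x. a < x \<Longrightarrow> x < b \<Longrightarrow> g x = x + c"
proof
  let ?m = "(a + b) / 2"
  fix x assume x: "a < x" "x < b"
  have "g x - x = g ?m - ?m"
  proof (rule DERIV_isconst3[OF \<open>a < b\<close>, of x ?m "\<lambda>x. g x - x"])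
    fix y assume "y \<in> {a<..<b}"
    then have "(g has_real_derivative 1) (at y)"
      unfolding has_field_derivative_iff
      using assms(1,2)[of y] by (intro filterlim_split_at) (auto simp: has_field_derivative_iff)
    then show "((\<lambda>x. g x - x) has_real_derivative 0) (at y)"
      using DERIV_diff[OF _ DERIV_ident] by force
  qed (use x in auto)
  then show "g x = x + (g ?m - ?m)" by simp
qed

section \<open>Monotonicity and concavity of the rise function\<close>

lemma DERIV_interior_01:
  assumes "(g has_real_derivative D) (at x within {0..1})" "0 < x" "x < 1"
  shows "(g has_real_derivative D) (at x)"
proof -
  have "(g has_real_derivative D) (at x within {0<..<1})"
    by (rule DERIV_subset[OF assms(1)]) auto
  then show ?thesis using assms(2,3) at_within_open[of x "{0<..<1}"] by simp
qed

lemma rise_function_continuous: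
  assumes "rise_function f"
  shows "continuous_on {0..1} f"
  unfolding continuous_on_eq_continuous_within
proof
  fix x :: real assume "x \<in> {0..1}"
  then obtain D where "(f has_real_derivative D) (at x within {0..1})"
    using assms unfolding rise_function_def by blast
  then show "continuous (at x within {0..1}) f" by (rule DERIV_continuous)
qed

lemma rise_function_strict_mono:
  assumes f: "rise_function f" and x: "0 \<le> x" "x < y" "y \<le> 1"
  shows "f x < f y"
proof (rule DERIV_pos_imp_increasing_open[OF \<open>x < y\<close>])
  show "continuous_on {x..y} f"
    using rise_function_continuous[OF f] by (rule continuous_on_subset) (use x in auto)
  show "\<exists>D. (f has_real_derivative D) (at z) \<and> 0 < D" if "x < z" "z < y" for z
  proof -
    have z: "z \<in> {0..1}" "0 < z" "z < 1" using x that by auto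
    then show ?thesis
      using f DERIV_interior_01 unfolding rise_function_def by blast
  qed
qed

lemma rise_function_mono:
  assumes "rise_function f" "0 \<le> x" "x \<le> y" "y \<le> 1"
  shows "f x \<le> f y"
  using rise_function_strict_mono[OF assms(1,2), of y] assms by (cases "x = y") auto

text \<open>Concavity in difference form: \<open>f'\<close> is strictly decreasing, so
  \<open>f (x + h) - f x\<close> has negative derivative in \<open>x\<close>. Differentiation is
  used only inside the interval; continuity covers the endpoints.\<close>

lemma rise_function_diff_antimono:
  assumes f: "rise_function f" and "0 \<le> b" "b \<le> a" "0 \<le> h" "a + h \<le> 1"
  shows "f (a + h) - f a \<le> f (b + h) - f b"
proof (cases "b = a \<or> h = 0")
  case False
  then have ba: "b < a" and h: "h > 0" using assms by auto
  obtain f' f'' where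
    f': "\<And>x. 0 \<le> x \<Longrightarrow> x \<le> 1 \<Longrightarrow> (f has_real_derivative f' x) (at x within {0..1})" and
    f'': "\<And>x. 0 \<le> x \<Longrightarrow> x \<le> 1 \<Longrightarrow> (f' has_real_derivative f'' x) (at x within {0..1})"
         "\<And>x. 0 \<le> x \<Longrightarrow> x \<le> 1 \<Longrightarrow> f'' x < 0"
    using f unfolding rise_function_def by (metis atLeastAtMost_iff)
  have dec: "f' y < f' x" if "0 < x" "x < y" "y < 1" for x y
  proof (rule DERIV_neg_imp_decreasing[OF \<open>x < y\<close>])
    show "\<exists>D. (f' has_real_derivative D) (at z) \<and> D < 0" if "x \<le> z" "z \<le> y" for z
      using \<open>0 < x\<close> \<open>y < 1\<close> that f''[of z] DERIV_interior_01[of f' "f'' z" z] by force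
  qed
  have "f (a + h) - f a < f (b + h) - f b"
  proof (rule DERIV_neg_imp_decreasing_open[OF ba])
    fix x assume x: "b < x" "x < a"
    have "(f has_real_derivative f' (x + h)) (at (x + h))"
      using f'[of "x + h"] x assms by (intro DERIV_interior_01) auto
    moreover have "(f has_real_derivative f' x) (at x)"
      using f'[of x] x assms by (intro DERIV_interior_01) auto
    ultimately have "((\<lambda>x. f (x + h) - f x) has_real_derivative f' (x + h) - f' x) (at x)"
      by (intro DERIV_diff) (simp_all add: DERIV_shift)
    moreover have "f' (x + h) < f' x" using x assms h by (intro dec) auto
    ultimately show "\<exists>D. ((\<lambda>x. f (x + h) - f x) has_real_derivative D) (at x) \<and> D < 0"
      by (intro exI[of _ "f' (x + h) - f' x"]) simp
  next
    note cont = rise_function_continuous[OF f]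
    have "continuous_on {b..a} (\<lambda>x. f (x + h))"
      by (rule continuous_on_compose2[OF cont]) (use assms in \<open>auto intro!: continuous_intros\<close>)
    moreover have "continuous_on {b..a} f"
      by (rule continuous_on_subset[OF cont]) (use assms in auto)
    ultimately show "continuous_on {b..a} (\<lambda>x. f (x + h) - f x)"
      by (rule continuous_on_diff)
  qed
  then show ?thesis by simp
qed auto

text \<open>Free evolution of two phases over the same time \<open>h\<close> does not enlarge a
  bound \<open>c\<close> on the excess of one potential over the other. Concavity gives this if
  \<open>a\<close> is ahead; otherwise monotonicity and \<open>0 \<le> c\<close> suffice.\<close>

lemma rise_function_add_le:
  assumes f: "rise_function f" and "0 \<le> a" "0 \<le> b" "0 \<le> h" "a + h \<le> 1" "b + h \<le> 1"
    and c: "0 \<le> c" "f a \<le> f b + c"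
  shows "f (a + h) \<le> f (b + h) + c"
proof (cases "b \<le> a")
  case True
  then show ?thesis using rise_function_diff_antimono[OF f, of b a h] assms by linarith
next
  case False
  then show ?thesis using rise_function_mono[OF f, of "a + h" "b + h"] assms by linarith
qed

lemma rise_function_inv_into:
  assumes f: "rise_function f" and y: "0 \<le> y" "y \<le> 1"
  shows "f (inv_into {0..1} f y) = y"
proof (rule f_inv_into_f)
  have "\<exists>x\<ge>0. x \<le> 1 \<and> f x = y"
    using f y by (intro IVT' rise_function_continuous) (auto simp: rise_function_def)
  then show "y \<in> f ` {0..1}" by auto
qed

section \<open>The potential between a reset and the next firing\<close>

text \<open>A set of senders rather than of spikes, so its total strength is at most that of
  \<open>Pre i\<close>. The time \<open>a\<close> is excluded because a spike arriving at the moment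
  of a reset acts before the reset.\<close>

definition received :: "('n \<Rightarrow> 'n set) \<Rightarrow> real \<Rightarrow> ('n \<Rightarrow> real \<Rightarrow> real) \<Rightarrow> 'n \<Rightarrow> real \<Rightarrow> real \<Rightarrow> 'n set"
  where "received Pre \<tau> \<phi> i a t = {j \<in> Pre i. \<exists>s. a < s \<and> s \<le> t \<and> fires \<phi> j (s - \<tau>)}"

text \<open>The bound is carried forward in time by \<open>real_induction\<close>. Without arrivals
  both \<open>\<phi> i t\<close> and \<open>t - t1\<close> grow with slope 1 and
  \<open>rise_function_add_le\<close> applies; at an arrival the potential rises by at most the
  strength of senders not counted before. The bound itself excludes a firing, which keeps the slope
  equal to 1.\<close>

lemma potential_after_reset:
  fixes Pre :: "'n::finite \<Rightarrow> 'n set"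
  assumes f: "rise_function f" and "0 < \<tau>" "\<tau> < 1"
    and w: "\<And>j. j \<in> Pre i \<Longrightarrow> w j i > 0"
    and total: "(\<Sum>j\<in>Pre i. w j i) = \<epsilon>" "f \<tau> + \<epsilon> < 1"
    and traj: "trajectory f Pre w \<tau> \<phi>"
    and fire: "fires \<phi> i t1" and "t2 \<le> t1 + \<tau>"
    and once: "\<And>j s s'. j \<in> Pre i \<Longrightarrow> fires \<phi> j (s - \<tau>) \<Longrightarrow> fires \<phi> j (s' - \<tau>) \<Longrightarrow>
       t1 < s \<Longrightarrow> s \<le> t2 \<Longrightarrow> t1 < s' \<Longrightarrow> s' \<le> t2 \<Longrightarrow> s = s'"
    and t: "t1 < t" "t \<le> t2"
  shows "f (\<phi> i t) \<le> f (t - t1) + (\<Sum>j\<in>received Pre \<tau> \<phi> i t1 t. w j i)"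
proof -
  define S where "S t = (\<Sum>j\<in>received Pre \<tau> \<phi> i t1 t. w j i)" for t
  define arr where "arr = arriving Pre \<tau> \<phi> i"
  define Inv where "Inv t \<longleftrightarrow> f (\<phi> i t) \<le> f (t - t1) + S t" for t
  have t1: "0 \<le> t1" using fire by (simp add: fires_def)
  have range: "0 \<le> \<phi> i t" "\<phi> i t \<le> 1" if "0 \<le> t" for t
    using traj that by (auto simp: trajectory_def)
  have deriv_left: "(\<phi> i has_real_derivative 1) (at_left t)" if "0 < t" "arr t = {}" for t
    using traj that by (auto simp: trajectory_def arr_def)
  have deriv_right: "(\<phi> i has_real_derivative 1) (at_right t)" if "0 \<le> t" "\<phi> i t \<noteq> 1" for t
    using traj that by (auto simp: trajectory_def fires_def)
  have reset: "(\<phi> i \<longlongrightarrow> 0) (at_right t1)"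
    using traj fire by (auto simp: trajectory_def fires_def)
  have arr_eq: "arr s = {j \<in> Pre i. fires \<phi> j (s - \<tau>)}" for s
    by (auto simp: arr_def arriving_def Post_def)
  have S_mono: "S s \<le> S t" if "s \<le> t" for s t
    unfolding S_def using that w
    by (intro sum_mono2) (auto simp: received_def intro: less_imp_le order_trans)
  have S_nonneg: "0 \<le> S t" for t
    unfolding S_def by (intro sum_nonneg) (auto simp: received_def w less_imp_le)
  have S_le: "S t \<le> \<epsilon>" for t
    unfolding S_def total(1)[symmetric]
    by (intro sum_mono2) (auto simp: received_def w less_imp_le)
  \<comment> \<open>By \<open>once\<close>, no sender arriving at \<open>t\<close> has been counted
    by time \<open>s\<close>, so the strengths add.\<close>
  have S_step: "S s + (\<Sum>j\<in>arr t. w j i) \<le> S t" if "s < t" "t1 < t" "t \<le> t2" for s t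
  proof -
    have "received Pre \<tau> \<phi> i t1 s \<inter> arr t = {}"
    proof (rule ccontr)
      assume "received Pre \<tau> \<phi> i t1 s \<inter> arr t \<noteq> {}"
      then obtain j r where "j \<in> Pre i" "t1 < r" "r \<le> s" "fires \<phi> j (r - \<tau>)" "fires \<phi> j (t - \<tau>)"
        by (auto simp: received_def arr_eq)
      then show False using once[of j r t] that by simp
    qed
    then have "S s + (\<Sum>j\<in>arr t. w j i) = (\<Sum>j\<in>received Pre \<tau> \<phi> i t1 s \<union> arr t. w j i)"
      unfolding S_def by (simp add: sum.union_disjoint)
    also have "\<dots> \<le> S t"
      unfolding S_def using that w
      by (intro sum_mono2) (auto simp: received_def arr_eq intro: less_imp_le order_trans)
    finally show ?thesis .
  qed
  \<comment> \<open>Each presynaptic oscillator contributes at most one arrival time, so every time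
    has spike-free intervals next to it.\<close>
  have fin: "finite {s. t1 < s \<and> s \<le> t2 \<and> arr s \<noteq> {}}" (is "finite ?A")
  proof (rule finite_subset)
    show "?A \<subseteq> (\<Union>j\<in>Pre i. {s. t1 < s \<and> s \<le> t2 \<and> fires \<phi> j (s - \<tau>)})"
      by (auto simp: arr_eq)
    have "finite {s. t1 < s \<and> s \<le> t2 \<and> fires \<phi> j (s - \<tau>)}" if "j \<in> Pre i" for j
    proof (cases "\<exists>s. t1 < s \<and> s \<le> t2 \<and> fires \<phi> j (s - \<tau>)")
      case True
      then obtain s where "t1 < s \<and> s \<le> t2 \<and> fires \<phi> j (s - \<tau>)" ..
      then have "{s. t1 < s \<and> s \<le> t2 \<and> fires \<phi> j (s - \<tau>)} \<subseteq> {s}"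
        using once[OF that] by blast
      then show ?thesis by (rule finite_subset) simp
    next
      case False
      then have "{s. t1 < s \<and> s \<le> t2 \<and> fires \<phi> j (s - \<tau>)} = {}" by blast
      then show ?thesis by (simp only: finite.emptyI)
    qed
    then show "finite (\<Union>j\<in>Pre i. {s. t1 < s \<and> s \<le> t2 \<and> fires \<phi> j (s - \<tau>)})" by simp
  qed
  have not_fires: "\<phi> i t < 1" if "Inv t" "t1 < t" "t \<le> t2" for t
  proof -
    have "f (t - t1) \<le> f \<tau>" using that assms by (intro rise_function_mono[OF f]) auto
    then have "f (\<phi> i t) < 1" using that S_le[of t] total by (simp add: Inv_def)
    then have "\<phi> i t \<noteq> 1" using f by (auto simp: rise_function_def)
    then show ?thesis using range[of t] t1 that by simp
  qed
  have "Inv t"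
  proof (rule real_induction[of t1 t2 Inv, OF _ _ t])
    fix T assume T: "t1 \<le> T" "T < t2" "T = t1 \<or> Inv T"
    \<comment> \<open>\<open>L\<close> is the phase just after \<open>T\<close>: 0 if
      \<open>T = t1\<close>, because of the reset, and otherwise \<open>\<phi> i T\<close>, since
      the invariant excludes a firing at \<open>T\<close>.\<close>
    obtain L where lim: "(\<phi> i \<longlongrightarrow> L) (at_right T)" and L: "0 \<le> L" "L < 1"
      and fL: "f L \<le> f (T - t1) + S T"
    proof (cases "T = t1")
      case True
      then show ?thesis using that[of 0] reset S_nonneg[of T] by simp
    next
      case False
      then have "Inv T" "t1 < T" using T by auto
      then have "\<phi> i T < 1" using not_fires T by auto
      moreover from this have "(\<phi> i \<longlongrightarrow> \<phi> i T) (at_right T)"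
        using DERIV_continuous[OF deriv_right[of T]] t1 T by (simp add: continuous_within)
      ultimately show ?thesis
        using that[of "\<phi> i T"] \<open>Inv T\<close> range[of T] t1 T by (simp add: Inv_def)
    qed
    obtain u1 where u1: "T < u1" "u1 \<le> t2" "\<And>x. T < x \<Longrightarrow> x < u1 \<Longrightarrow> x \<notin> ?A"
      using finite_gap_right[OF fin T(2)] by blast
    have "eventually (\<lambda>x. \<phi> i x < 1) (at_right T)"
      using lim L(2) by (rule order_tendstoD(2))
    then obtain u2 where u2: "T < u2" "\<And>x. T < x \<Longrightarrow> x < u2 \<Longrightarrow> \<phi> i x < 1"
      unfolding eventually_at_right_field by blast
    \<comment> \<open>Below \<open>u1\<close> no spike arrives, which gives the left derivatives;
      below \<open>u2\<close> no firing occurs, which gives the right derivatives.\<close>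
    define u where "u = min u1 u2"
    have u: "T < u" "u \<le> t2" using u1 u2 by (auto simp: u_def)
    obtain c where c: "\<And>x. T < x \<Longrightarrow> x < u \<Longrightarrow> \<phi> i x = x + c"
    proof (rule DERIV_one_affine[of T u "\<phi> i"])
      fix x assume x: "T < x" "x < u"
      show "(\<phi> i has_real_derivative 1) (at_left x)"
        using x u1 T t1 by (intro deriv_left) (auto simp: u_def)
      show "(\<phi> i has_real_derivative 1) (at_right x)"
        using x u2(2)[of x] T t1 by (intro deriv_right) (auto simp: u_def)
    qed (use u in auto)
    have "(\<phi> i \<longlongrightarrow> T + c) (at_right T)"
    proof (rule Lim_transform_eventually)
      show "((\<lambda>x. x + c) \<longlongrightarrow> T + c) (at_right T)" by (intro tendsto_intros)
      show "eventually (\<lambda>x. x + c = \<phi> i x) (at_right T)"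
        using c u unfolding eventually_at_right_field by auto
    qed
    then have L_eq: "L = T + c" by (rule tendsto_unique[OF trivial_limit_at_right_real lim])
    show "\<exists>u>T. \<forall>t. T < t \<and> t < u \<longrightarrow> Inv t"
    proof (intro exI conjI allI impI)
      fix x assume x: "T < x \<and> x < u"
      \<comment> \<open>Both arguments advance by \<open>x - T\<close>, starting from the bound
        \<open>fL\<close> at \<open>T\<close>.\<close>
      have "f (L + (x - T)) \<le> f (T - t1 + (x - T)) + S T"
        using x u T t1 L fL S_nonneg[of T] c[of x] range[of x] assms L_eq
        by (intro rise_function_add_le[OF f]) auto
      then show "Inv x" using c[of x] x L_eq S_mono[of T x] by (simp add: Inv_def add.commute)
    qed (rule u)
  next
    fix T assume T: "t1 < T" "T \<le> t2" and IH: "\<And>t. t1 < t \<Longrightarrow> t < T \<Longrightarrow> Inv t"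
    obtain u where u: "t1 \<le> u" "u < T" "\<And>x. u < x \<Longrightarrow> x < T \<Longrightarrow> x \<notin> ?A"
      using finite_gap_left[OF fin T(1)] by blast
    obtain c where c: "\<And>x. u < x \<Longrightarrow> x < T \<Longrightarrow> \<phi> i x = x + c"
    proof (rule DERIV_one_affine[of u T "\<phi> i"])
      fix x assume x: "u < x" "x < T"
      show "(\<phi> i has_real_derivative 1) (at_left x)"
        using x u T t1 by (intro deriv_left) auto
      show "(\<phi> i has_real_derivative 1) (at_right x)"
        using not_fires[OF IH[of x]] x u T t1 by (intro deriv_right) auto
    qed (use u in auto)
    \<comment> \<open>\<open>l\<close> is the phase just before any spikes arriving at
      \<open>T\<close> take effect.\<close>
    define l where "l = T + c"
    \<comment> \<open>Any time in the spike-free interval before \<open>T\<close> would serve. The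
      induction hypothesis holds there, and arrivals at \<open>T\<close> have not yet entered
      \<open>S s\<close>.\<close>
    define s where "s = (u + T) / 2"
    have s: "u < s" "s < T" using u by (auto simp: s_def)
    have lim: "(\<phi> i \<longlongrightarrow> l) (at_left T)"
    proof (rule Lim_transform_eventually)
      show "((\<lambda>x. x + c) \<longlongrightarrow> l) (at_left T)" unfolding l_def by (intro tendsto_intros)
      show "eventually (\<lambda>x. x + c = \<phi> i x) (at_left T)"
        using c u unfolding eventually_at_left_field by auto
    qed
    have ev: "eventually (\<lambda>x. \<phi> i x \<in> {0..1}) (at_left T)"
      using T t1 range unfolding eventually_at_left_field by (intro exI[of _ t1]) auto
    have l: "0 \<le> l" "l \<le> 1"
      using Lim_in_closed_set[OF closed_atLeastAtMost ev _ lim] by simp_all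
    have "f (\<phi> i s + (T - s)) \<le> f (s - t1 + (T - s)) + S s"
      using s u T t1 l range[of s] S_nonneg[of s] IH[of s] c[of s] assms
      by (intro rise_function_add_le[OF f]) (auto simp: Inv_def l_def)
    then have fl: "f l \<le> f (T - t1) + S s" using c[of s] s by (simp add: l_def add.commute)
    show "Inv T"
    proof (cases "arr T = {}")
      case True
      then have "(\<phi> i \<longlongrightarrow> \<phi> i T) (at_left T)"
        using DERIV_continuous[OF deriv_left[of T]] t1 T by (simp add: continuous_within)
      then have "\<phi> i T = l" by (rule tendsto_unique[OF trivial_limit_at_left_real _ lim])
      then show ?thesis using fl S_mono[of s T] s by (simp add: Inv_def)
    next
      case False
      \<comment> \<open>The cap at 1 can only lower the potential, and it keeps \<open>?y\<close> in
        the range where \<open>f\<close> undoes \<open>inv_into\<close>.\<close>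
      let ?y = "min 1 (f l + (\<Sum>j\<in>arr T. w j i))"
      obtain l' where "(\<phi> i \<longlongrightarrow> l') (at_left T)"
        "\<phi> i T = inv_into {0..1} f (min 1 (f l' + (\<Sum>j\<in>arr T. w j i)))"
        using traj False t1 T unfolding trajectory_def arr_def
        by (meson order_le_less_trans)
      moreover from this(1) have "l' = l" by (rule tendsto_unique[OF trivial_limit_at_left_real _ lim])
      ultimately have "\<phi> i T = inv_into {0..1} f ?y" by simp
      moreover have "0 \<le> ?y"
      proof -
        have "0 \<le> (\<Sum>j\<in>arr T. w j i)" using w by (intro sum_nonneg) (auto simp: arr_eq less_imp_le)
        moreover have "0 \<le> f l"
          using rise_function_mono[OF f, of 0 l] l f by (simp add: rise_function_def)
        ultimately show ?thesis by simp
      qed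
      ultimately have "f (\<phi> i T) = ?y" by (simp add: rise_function_inv_into[OF f])
      then show ?thesis using fl S_step[of s T] s T by (simp add: Inv_def)
    qed
  qed
  then show ?thesis by (simp add: Inv_def S_def)
qed

theorem theorem1:
  fixes f :: "real \<Rightarrow> real"
    and Pre :: "'n::finite \<Rightarrow> 'n set"
    and w :: "'n \<Rightarrow> 'n \<Rightarrow> real"
    and \<tau> \<epsilon> :: real
    and \<phi> :: "'n \<Rightarrow> real \<Rightarrow> real"
  assumes "rise_function f"
    and "0 < \<tau>" and "\<tau> < 1"
    and "0 < \<epsilon>" and "\<epsilon> < 1"
    and "\<And>i. i \<notin> Pre i"
    and "\<And>i j. i \<in> Pre j \<Longrightarrow> w i j > 0"
    and "\<And>i. (\<Sum>j\<in>Pre i. w j i) = \<epsilon>"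
    and "f \<tau> + \<epsilon> < 1"
    and "\<And>i. 0 < \<phi> i 0 \<and> \<phi> i 0 \<le> 1"
    and "trajectory f Pre w \<tau> \<phi>"
  shows "\<forall>i t1 t2. successive_firings \<phi> i t1 t2 \<longrightarrow> t2 - t1 > \<tau>"
proof -
  \<comment> \<open>Stated for arbitrary pairs of firings, not only successive ones, so that the
    induction hypothesis separates any two spikes of one sender. The number \<open>n\<close> counts
    slabs of length \<open>\<tau>\<close>; for \<open>n = 0\<close> no two distinct firing times
    exist.\<close>
  have gap: "t2 - t1 > \<tau>"
    if "fires \<phi> i t1" "fires \<phi> i t2" "t1 < t2" "t2 \<le> real n * \<tau>" for n i t1 t2
    using that
  proof (induction n arbitrary: i t1 t2)
    case 0
    then show ?case by (auto simp: fires_def)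
  next
    case (Suc n)
    show ?case
    proof (rule ccontr)
      assume "\<not> t2 - t1 > \<tau>"
      then have near: "t2 \<le> t1 + \<tau>" by simp
      \<comment> \<open>Spikes arriving by \<open>t2\<close> were emitted by
        \<open>t2 - \<tau>\<close>, one slab earlier, so the induction hypothesis puts their
        emissions more than \<open>\<tau>\<close> apart. Two arrivals in \<open>(t1, t2]\<close> are
        less than \<open>\<tau>\<close> apart.\<close>
      have once: "\<not> s < s'" if "fires \<phi> j (s - \<tau>)" "fires \<phi> j (s' - \<tau>)"
        "t1 < s" "s' \<le> t2" for j s s'
      proof
        assume "s < s'"
        moreover have "s' - \<tau> \<le> real n * \<tau>" using Suc.prems(4) that by (simp add: algebra_simps)
        ultimately show False using Suc.IH[OF that(1,2)] that near by simp
      qed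
      let ?R = "received Pre \<tau> \<phi> i t1 t2"
      have "f (\<phi> i t2) \<le> f (t2 - t1) + (\<Sum>j\<in>?R. w j i)"
      proof (rule potential_after_reset[where w=w and \<epsilon>=\<epsilon>, OF assms(1-3) _ assms(8,9,11) Suc.prems(1) near])
        show "s = s'" if "fires \<phi> j (s - \<tau>)" "fires \<phi> j (s' - \<tau>)"
          "t1 < s" "s \<le> t2" "t1 < s'" "s' \<le> t2" for j s s'
          using once[of j s s'] once[of j s' s] that by simp
      qed (use assms(7) Suc.prems(3) in auto)
      moreover have "f (t2 - t1) \<le> f \<tau>"
        using assms(1-3) near Suc.prems(3) by (intro rise_function_mono[OF assms(1)]) auto
      moreover have "(\<Sum>j\<in>?R. w j i) \<le> (\<Sum>j\<in>Pre i. w j i)"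
        using assms(7) by (intro sum_mono2) (auto simp: received_def less_imp_le)
      \<comment> \<open>A firing at \<open>t2\<close> would require potential
        \<open>f 1 = 1\<close>.\<close>
      ultimately have "f (\<phi> i t2) < 1" using assms(8)[of i] assms(9) by linarith
      then show False
        using Suc.prems(2) assms(1) by (simp add: fires_def rise_function_def)
    qed
  qed
  show ?thesis
  proof (intro allI impI)
    fix i t1 t2 assume "successive_firings \<phi> i t1 t2"
    moreover obtain n where "t2 / \<tau> \<le> real n" using real_arch_simple by blast
    then have "t2 \<le> real n * \<tau>" using assms(2) by (simp add: field_simps)
    ultimately show "t2 - t1 > \<tau>" using gap by (auto simp: successive_firings_def)
  qed
qed

end
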